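(* Let $\Lambda=\bigoplus_{p=0}^{n}\Lambda^p$ be a finite-dimensional graded real vector space with a linear map $d:\Lambda\to\Lambda$ satisfying $d(\Lambda^p)\subseteq\Lambda^{p+1}$ and $d^2=0$ (for instance the space of differential forms on a finite abstract simplicial complex with its exterior derivative). Let $i_X:\Lambda\to\Lambda$ be a linear map with $i_X(\Lambda^p)\subseteq\Lambda^{p-1}$ for all $p$ and $i_X^2=0$, and let $L_X=i_Xd+d\,i_X$. Put $\Lambda^{even}=\bigoplus_{p\text{ even}}\Lambda^p$ and $\Lambda^{odd}=\bigoplus_{p\text{ odd}}\Lambda^p$, both of which are invariant under $L_X$. Then the non-zero (complex) spectrum of $L_X$ restricted to $\Lambda^{even}$ is the same as the non-zero spectrum of $L_X$ restricted to $\Lambda^{odd}$, eigenvalues being counted with multiplicity.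
   Context: Conventions: $\Lambda^{-1}=\Lambda^{n+1}=0$. The map $i_X$ is the interior derivative of a vector field $X$, and $L_X$ is its Lie derivative, which maps each $\Lambda^p$ to itself. Eigenvalues are taken over $\mathbb{C}$ (that is, of the complexified operator), with algebraic multiplicity. For a finite abstract simplicial complex $G$ (a finite set of non-empty finite sets closed under taking non-empty subsets), $\Lambda^p$ is the space of real-valued functions on the $p$-dimensional simplices of $G$ (the sets in $G$ with $p+1$ elements), each simplex carrying a fixed orientation, and $d$ is the usual simplicial coboundary operator. *)

theory Defs
  imports "Jordan_Normal_Form.Char_Poly" "HOL-Computational_Algebra.Computational_Algebra"
begin

definition lie_derivative :: "('a \<Rightarrow> 'a) \<Rightarrow> ('a \<Rightarrow> 'a) \<Rightarrow> 'a \<Rightarrow> 'a::real_vector" where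
  "lie_derivative i d x = i (d x) + d (i x)"

(* Span of the union is the internal sum of the pieces; it is direct when the pieces grade the space. *)

definition even_part :: "(int \<Rightarrow> 'a set) \<Rightarrow> 'a::real_vector set" where
  "even_part \<Lambda> = span (\<Union>p\<in>{p. even p}. \<Lambda> p)"

definition odd_part :: "(int \<Rightarrow> 'a set) \<Rightarrow> 'a::real_vector set" where
  "odd_part \<Lambda> = span (\<Union>p\<in>{p. odd p}. \<Lambda> p)"

definition basis_list :: "'a::real_vector set \<Rightarrow> 'a list \<Rightarrow> bool" where
  "basis_list W bs \<longleftrightarrow> distinct bs \<and> independent (set bs) \<and> span (set bs) = W"

(* Column j holds the coordinates with respect to cs of the image of the j-th vector of bs. *)

definition matrix_wrt :: "'a::real_vector list \<Rightarrow> 'a list \<Rightarrow> ('a \<Rightarrow> 'a) \<Rightarrow> real mat" where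
  "matrix_wrt cs bs T =
     mat (length cs) (length bs) (\<lambda>(i, j). representation (set cs) (T (bs ! j)) (cs ! i))"

(* A real basis of W is also a complex basis of the complexification of W, and in it the
   complexified operator has the same matrix, read over the complex numbers.  The choice of
   the basis is immaterial, see complex_char_poly_on_eq below. *)

definition complex_char_poly_on :: "'a::real_vector set \<Rightarrow> ('a \<Rightarrow> 'a) \<Rightarrow> complex poly" where
  "complex_char_poly_on W T =
     (let bs = (SOME bs. basis_list W bs)
      in char_poly (map_mat complex_of_real (matrix_wrt bs bs T)))"

(* The complex eigenvalues of the restriction of T to the finite-dimensional T-invariant
   subspace W, each as often as its algebraic multiplicity. *)

definition complex_spectrum_on :: "'a::real_vector set \<Rightarrow> ('a \<Rightarrow> 'a) \<Rightarrow> complex multiset" where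
  "complex_spectrum_on W T = proots (complex_char_poly_on W T)"


lemma matrix_wrt_carrier [simp]: "matrix_wrt cs bs T \<in> carrier_mat (length cs) (length bs)"
  by (simp add: matrix_wrt_def)

lemma basis_list_exists:
  fixes W :: "'a::real_vector set"
  assumes "subspace W" and "finite S" and "W \<subseteq> span S"
  shows "\<exists>bs. basis_list W bs"
proof -
  obtain B where B: "B \<subseteq> W" "independent B" "W \<subseteq> span B"
    using maximal_independent_subset by blast
  have "finite B"
    using independent_span_bound[OF \<open>finite S\<close> \<open>independent B\<close>] B(1) assms(3) by blast
  then obtain bs where bs: "set bs = B" "distinct bs"
    using finite_distinct_list by blast
  have "span B = W"
    using B assms(1) by (simp add: span_subspace)
  with bs B(2) show ?thesis
    by (auto simp: basis_list_def)
qed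

lemma basis_list_length:
  assumes "basis_list W bs" and "basis_list W cs"
  shows "length bs = length cs"
  using assms dim_eq_card_independent[of "set bs"] dim_eq_card_independent[of "set cs"]
  by (metis basis_list_def dim_span distinct_card)

lemma matrix_wrt_mult:
  fixes T S :: "'a::real_vector \<Rightarrow> 'a"
  assumes ds: "basis_list W ds" and cs: "basis_list W cs"
    and T: "linear T" "T ` W \<subseteq> W" and S: "S ` set bs \<subseteq> W"
  shows "matrix_wrt ds cs T * matrix_wrt cs bs S = matrix_wrt ds bs (T \<circ> S)"
proof (rule eq_matI)
  fix i j
  assume "i < dim_row (matrix_wrt ds bs (T \<circ> S))" and "j < dim_col (matrix_wrt ds bs (T \<circ> S))"
  then have i: "i < length ds" and j: "j < length bs"
    by (auto simp: matrix_wrt_def)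
  let ?r = "representation (set cs) (S (bs ! j))"
  have Sj: "S (bs ! j) \<in> span (set cs)"
    using S j cs by (auto simp: basis_list_def)
  have indc: "independent (set cs)" and indd: "independent (set ds)"
    using cs ds by (auto simp: basis_list_def)
  have cW: "T c \<in> span (set ds)" if "c \<in> set cs" for c
  proof -
    have "c \<in> W" using that cs span_base by (auto simp: basis_list_def)
    then show ?thesis using T(2) ds by (auto simp: basis_list_def)
  qed
  have eq: "S (bs ! j) = (\<Sum>c\<in>set cs. ?r c *\<^sub>R c)"
    using sum_representation_eq[OF indc Sj, of "set cs"] by simp
  have "T (S (bs ! j)) = (\<Sum>c\<in>set cs. ?r c *\<^sub>R T c)"
    by (subst eq) (simp add: linear_sum[OF T(1)] linear_scale[OF T(1)])
  then have "representation (set ds) (T (S (bs ! j))) (ds ! i)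
      = (\<Sum>c\<in>set cs. ?r c * representation (set ds) (T c) (ds ! i))"
    using cW by (simp add: representation_sum[OF indd] representation_scale[OF indd] span_scale)
  also have "\<dots> = (\<Sum>k<length cs. ?r (cs ! k) * representation (set ds) (T (cs ! k)) (ds ! i))"
    using cs by (intro sum.reindex_bij_betw[symmetric] bij_betw_nth) (auto simp: basis_list_def)
  finally show "(matrix_wrt ds cs T * matrix_wrt cs bs S) $$ (i, j)
      = matrix_wrt ds bs (T \<circ> S) $$ (i, j)"
    using i j
    by (simp add: matrix_wrt_def scalar_prod_def mult.commute lessThan_atLeast0)
qed (auto simp: matrix_wrt_def)

lemma matrix_wrt_id:
  assumes "basis_list W bs"
  shows "matrix_wrt bs bs id = 1\<^sub>m (length bs)"
  using assms
  by (intro eq_matI)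
    (auto simp: matrix_wrt_def basis_list_def representation_basis nth_eq_iff_index_eq)

lemma similar_matrix_wrt:
  fixes T :: "'a::real_vector \<Rightarrow> 'a"
  assumes bs: "basis_list W bs" and cs: "basis_list W cs" and T: "linear T" "T ` W \<subseteq> W"
  shows "similar_mat (matrix_wrt bs bs T) (matrix_wrt cs cs T)"
proof (rule similar_matI)
  have len: "length cs = length bs"
    using basis_list_length[OF cs bs] .
  have sub: "set bs \<subseteq> W" "set cs \<subseteq> W"
    using bs cs span_base by (auto simp: basis_list_def)
  have Tsub: "T ` set bs \<subseteq> W" "T ` set cs \<subseteq> W"
    using sub T(2) by auto
  have lid: "linear (id :: 'a \<Rightarrow> 'a)"
    by (rule linear_id)
  show "{matrix_wrt bs bs T, matrix_wrt cs cs T, matrix_wrt bs cs id, matrix_wrt cs bs id}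
      \<subseteq> carrier_mat (length bs) (length bs)"
    using len by (auto simp: matrix_wrt_def)
  show "matrix_wrt bs cs id * matrix_wrt cs bs id = 1\<^sub>m (length bs)"
    using matrix_wrt_mult[OF bs cs lid, of id bs] sub matrix_wrt_id[OF bs] by simp
  show "matrix_wrt cs bs id * matrix_wrt bs cs id = 1\<^sub>m (length bs)"
    using matrix_wrt_mult[OF cs bs lid, of id cs] sub matrix_wrt_id[OF cs] len by simp
  show "matrix_wrt bs bs T = matrix_wrt bs cs id * matrix_wrt cs cs T * matrix_wrt cs bs id"
    using matrix_wrt_mult[OF bs cs lid, of T cs] matrix_wrt_mult[OF bs cs T, of id bs] sub Tsub
    by simp
qed

lemma complex_char_poly_on_eq:
  fixes T :: "'a::real_vector \<Rightarrow> 'a"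
  assumes bs: "basis_list W bs" and T: "linear T" "T ` W \<subseteq> W"
  shows "complex_char_poly_on W T = char_poly (map_mat complex_of_real (matrix_wrt bs bs T))"
proof -
  let ?cs = "SOME bs. basis_list W bs"
  have cs: "basis_list W ?cs"
    using bs by (rule someI)
  have hom: "char_poly (map_mat complex_of_real (matrix_wrt xs xs T))
      = map_poly complex_of_real (char_poly (matrix_wrt xs xs T))" for xs
    by (rule of_real_hom.char_poly_hom[OF matrix_wrt_carrier])
  have "char_poly (matrix_wrt ?cs ?cs T) = char_poly (matrix_wrt bs bs T)"
    by (intro char_poly_similar similar_matrix_wrt[OF cs bs T])
  then show ?thesis
    by (simp add: complex_char_poly_on_def Let_def hom)
qed

end

theory Submission
  imports Defs
begin

text \<open>
  Put \<open>D = d + i\<^sub>X\<close>.  Since \<open>d\<close> and \<open>i\<^sub>X\<close> both square to zero, \<open>D\<^sup>2 = L\<^sub>X\<close>: the operator \<open>D\<close> is a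
  Dirac-type square root of the Lie derivative.  It shifts degrees by one, so it exchanges the even
  and the odd part.  With \<open>A\<close> the matrix of \<open>D\<close> from even to odd and \<open>B\<close> the matrix of \<open>D\<close> from odd
  to even, the restrictions of \<open>L\<^sub>X\<close> have the matrices \<open>B A\<close> and \<open>A B\<close>.  The matrices need not be
  square, but \<open>A B\<close> and \<open>B A\<close> always have the same characteristic polynomial up to a power of the
  variable (\<open>char_poly_mult_commute\<close>), and such a power contributes only zero roots.
\<close>

lemma char_poly_matrix_mult:
  fixes A B :: "'a::comm_ring_1 mat"
  assumes A: "A \<in> carrier_mat n m" and B: "B \<in> carrier_mat m n"
  shows "char_poly_matrix (A * B) =
    [:0, 1:] \<cdot>\<^sub>m 1\<^sub>m n + map_mat (\<lambda>a. [:a:]) A * - map_mat (\<lambda>a. [:a:]) B"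
proof -
  have "map_mat (\<lambda>a. [:- a:]) (A * B) = - map_mat (\<lambda>a. [:a:]) (A * B)"
    by (rule eq_matI) auto
  also have "\<dots> = map_mat (\<lambda>a. [:a:]) A * - map_mat (\<lambda>a. [:a:]) B"
    using A B by (simp add: map_poly_mult(1)[OF A B])
  finally show ?thesis
    using A by (simp add: char_poly_matrix_def)
qed

text \<open>
  Over the polynomials in \<open>X\<close>, the block matrix \<open>M = (X, A; B, 1)\<close> can be cleared in two ways: a
  column operation makes it block triangular with diagonal blocks \<open>X - A B\<close> and \<open>1\<close>, and a row
  operation (which multiplies the determinant by \<open>X ^ m\<close>) makes it block triangular with diagonal
  blocks \<open>X\<close> and \<open>X - B A\<close>.  The two resulting values of \<open>X ^ m * det M\<close> are the two sides.
\<close>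

lemma char_poly_mult_commute:
  fixes A B :: "'a::idom mat"
  assumes A: "A \<in> carrier_mat n m" and B: "B \<in> carrier_mat m n"
  shows "[:0, 1:] ^ m * char_poly (A * B) = [:0, 1:] ^ n * char_poly (B * A)"
proof -
  define P where "P = map_mat (\<lambda>a. [:a:]) A"
  define Q where "Q = map_mat (\<lambda>a. [:a:]) B"
  let ?X = "[:0, 1:] :: 'a poly"
  let ?M = "four_block_mat (?X \<cdot>\<^sub>m 1\<^sub>m n) P Q (1\<^sub>m m)"
  let ?C = "four_block_mat (1\<^sub>m n) (0\<^sub>m n m) (- Q) (1\<^sub>m m)"
  let ?R = "four_block_mat (1\<^sub>m n) (0\<^sub>m n m) (- Q) (?X \<cdot>\<^sub>m 1\<^sub>m m)"
  have P: "P \<in> carrier_mat n m" and Q: "Q \<in> carrier_mat m n"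
    using A B by (auto simp: P_def Q_def)
  have AB: "char_poly_matrix (A * B) = ?X \<cdot>\<^sub>m 1\<^sub>m n + P * - Q"
    using char_poly_matrix_mult[OF A B] by (simp add: P_def Q_def)
  have BA: "char_poly_matrix (B * A) = - Q * P + ?X \<cdot>\<^sub>m 1\<^sub>m m"
    using char_poly_matrix_mult[OF B A] P Q
    by (simp add: P_def[symmetric] Q_def[symmetric] comm_add_mat[of _ m m])
  have M: "?M \<in> carrier_mat (n + m) (n + m)" and C: "?C \<in> carrier_mat (n + m) (n + m)"
    and R: "?R \<in> carrier_mat (n + m) (n + m)"
    using P Q by auto
  have "?M * ?C = four_block_mat (char_poly_matrix (A * B)) P (0\<^sub>m m n) (1\<^sub>m m)"
    unfolding AB using P Q by (subst mult_four_block_mat[of _ n n _ m _ m _ _ n _ m]) auto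
  then have "det ?M * det ?C = det (four_block_mat (char_poly_matrix (A * B)) P (0\<^sub>m m n) (1\<^sub>m m))"
    using det_mult[OF M C] by simp
  also have "\<dots> = char_poly (A * B)"
    using A B P by (subst det_four_block_mat_lower_left_zero[of _ n _ m]) (auto simp: char_poly_def)
  finally have detM: "det ?M = char_poly (A * B)"
    using Q by (simp add: det_four_block_mat_upper_right_zero[of _ n _ m])
  have "?R * ?M = four_block_mat (?X \<cdot>\<^sub>m 1\<^sub>m n) P (0\<^sub>m m n) (char_poly_matrix (B * A))"
    unfolding BA using P Q
    by (subst mult_four_block_mat[of _ n n _ m _ m _ _ n _ m]) auto
  then have "det ?R * det ?M =
      det (four_block_mat (?X \<cdot>\<^sub>m 1\<^sub>m n) P (0\<^sub>m m n) (char_poly_matrix (B * A)))"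
    using det_mult[OF R M] by simp
  also have "\<dots> = ?X ^ n * char_poly (B * A)"
    using A B P by (subst det_four_block_mat_lower_left_zero[of _ n _ m]) (auto simp: char_poly_def)
  finally show ?thesis
    using Q by (simp add: det_four_block_mat_upper_right_zero[of _ n _ m] detM)
qed

lemma nonzero_proots_pX_power_mult:
  fixes p :: "'a::idom poly"
  assumes "p \<noteq> 0"
  shows "filter_mset (\<lambda>z. z \<noteq> 0) (proots ([:0, 1:] ^ n * p)) = filter_mset (\<lambda>z. z \<noteq> 0) (proots p)"
proof -
  have "filter_mset (\<lambda>z. z \<noteq> 0) (repeat_mset n {#0::'a#}) = {#}"
    by (induction n) auto
  then show ?thesis
    using assms by (simp add: proots_mult proots_power)
qed

lemma nonzero_proots_char_poly_mult_commute:
  fixes A B :: "'a::idom mat"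
  assumes A: "A \<in> carrier_mat n m" and B: "B \<in> carrier_mat m n"
  shows "filter_mset (\<lambda>z. z \<noteq> 0) (proots (char_poly (A * B))) =
    filter_mset (\<lambda>z. z \<noteq> 0) (proots (char_poly (B * A)))"
proof -
  have nz: "char_poly (A * B) \<noteq> 0" "char_poly (B * A) \<noteq> 0"
    using degree_monic_char_poly[of "A * B" n] degree_monic_char_poly[of "B * A" m] A B by auto
  show ?thesis
    using nonzero_proots_pX_power_mult[OF nz(1), of m] nonzero_proots_pX_power_mult[OF nz(2), of n]
    by (simp add: char_poly_mult_commute[OF A B])
qed

text \<open>
  The middle space \<open>span (set cs)\<close> is allowed to differ from the outer ones, because the two halves
  of an operator that exchanges two subspaces map between different spaces.
\<close>

lemma matrix_wrt_comp:
  fixes T S :: "'a::real_vector \<Rightarrow> 'a"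
  assumes indc: "independent (set cs)" "distinct cs" and indd: "independent (set ds)"
    and T: "linear T" "T ` set cs \<subseteq> span (set ds)" and S: "S ` set bs \<subseteq> span (set cs)"
  shows "matrix_wrt ds cs T * matrix_wrt cs bs S = matrix_wrt ds bs (T \<circ> S)"
proof (rule eq_matI)
  fix i j
  assume "i < dim_row (matrix_wrt ds bs (T \<circ> S))" and "j < dim_col (matrix_wrt ds bs (T \<circ> S))"
  then have i: "i < length ds" and j: "j < length bs"
    by (auto simp: matrix_wrt_def)
  let ?r = "representation (set cs) (S (bs ! j))"
  have Sj: "S (bs ! j) \<in> span (set cs)"
    using S j by auto
  have eq: "S (bs ! j) = (\<Sum>c\<in>set cs. ?r c *\<^sub>R c)"
    using sum_representation_eq[OF indc(1) Sj, of "set cs"] by simp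
  have "T (S (bs ! j)) = (\<Sum>c\<in>set cs. ?r c *\<^sub>R T c)"
    by (subst eq) (simp add: linear_sum[OF T(1)] linear_scale[OF T(1)])
  then have "representation (set ds) (T (S (bs ! j))) (ds ! i)
      = (\<Sum>c\<in>set cs. ?r c * representation (set ds) (T c) (ds ! i))"
    using T(2)
    by (simp add: representation_sum[OF indd] representation_scale[OF indd] span_scale image_subset_iff)
  also have "\<dots> = (\<Sum>k<length cs. ?r (cs ! k) * representation (set ds) (T (cs ! k)) (ds ! i))"
    using indc by (intro sum.reindex_bij_betw[symmetric] bij_betw_nth) auto
  finally show "(matrix_wrt ds cs T * matrix_wrt cs bs S) $$ (i, j)
      = matrix_wrt ds bs (T \<circ> S) $$ (i, j)"
    using i j by (simp add: matrix_wrt_def scalar_prod_def mult.commute lessThan_atLeast0)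
qed (auto simp: matrix_wrt_def)

text \<open>
  When \<open>T\<close> exchanges \<open>V\<close> and \<open>W\<close>, its square restricted to either subspace is a composition of the two halves
  \<open>V \<rightarrow> W\<close> and \<open>W \<rightarrow> V\<close> of \<open>T\<close>, taken in one or the other order.
\<close>

lemma nonzero_complex_spectrum_on_square:
  fixes T :: "'a::real_vector \<Rightarrow> 'a"
  assumes V: "basis_list V bs" and W: "basis_list W cs"
    and T: "linear T" "T ` V \<subseteq> W" "T ` W \<subseteq> V"
  shows "filter_mset (\<lambda>z. z \<noteq> 0) (complex_spectrum_on V (T \<circ> T)) =
    filter_mset (\<lambda>z. z \<noteq> 0) (complex_spectrum_on W (T \<circ> T))"
proof -
  let ?A = "map_mat complex_of_real (matrix_wrt cs bs T)"
  let ?B = "map_mat complex_of_real (matrix_wrt bs cs T)"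
  have A: "?A \<in> carrier_mat (length cs) (length bs)" and B: "?B \<in> carrier_mat (length bs) (length cs)"
    by auto
  have spanV: "span (set bs) = V" and spanW: "span (set cs) = W"
    using V W by (auto simp: basis_list_def)
  have sub: "T ` set bs \<subseteq> span (set cs)" "T ` set cs \<subseteq> span (set bs)"
    using T span_superset[of "set bs"] span_superset[of "set cs"] unfolding spanV spanW by blast+
  have prodV: "matrix_wrt bs cs T * matrix_wrt cs bs T = matrix_wrt bs bs (T \<circ> T)"
    and prodW: "matrix_wrt cs bs T * matrix_wrt bs cs T = matrix_wrt cs cs (T \<circ> T)"
    using V W T(1) sub by (auto simp: basis_list_def intro!: matrix_wrt_comp)
  have lin: "linear (T \<circ> T)"
    using T(1) by (intro linear_compose)
  have inv: "(T \<circ> T) ` V \<subseteq> V" "(T \<circ> T) ` W \<subseteq> W"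
    using T(2,3) by (auto simp: image_subset_iff)
  have "?B * ?A = map_mat complex_of_real (matrix_wrt bs bs (T \<circ> T))"
    unfolding prodV[symmetric]
    by (rule of_real_hom.mat_hom_mult[symmetric]) (rule matrix_wrt_carrier)+
  then have "complex_spectrum_on V (T \<circ> T) = proots (char_poly (?B * ?A))"
    by (simp only: complex_spectrum_on_def complex_char_poly_on_eq[OF V lin inv(1)])
  moreover have "?A * ?B = map_mat complex_of_real (matrix_wrt cs cs (T \<circ> T))"
    unfolding prodW[symmetric]
    by (rule of_real_hom.mat_hom_mult[symmetric]) (rule matrix_wrt_carrier)+
  then have "complex_spectrum_on W (T \<circ> T) = proots (char_poly (?A * ?B))"
    by (simp only: complex_spectrum_on_def complex_char_poly_on_eq[OF W lin inv(2)])
  ultimately show ?thesis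
    using nonzero_proots_char_poly_mult_commute[OF B A] by simp
qed

lemma lie_derivative_eq_square:
  assumes "linear d" "\<And>x. d (d x) = 0" "linear i" "\<And>x. i (i x) = 0"
  shows "lie_derivative i d = (\<lambda>x. d x + i x) \<circ> (\<lambda>x. d x + i x)"
  using assms by (auto simp: fun_eq_iff lie_derivative_def linear_add)

text \<open>
  Both \<open>p + 1\<close> and \<open>p - 1\<close> have the parity opposite to that of \<open>p\<close>, so adding a map that raises
  the degree to one that lowers it still gives an odd operator.
\<close>

lemma odd_operator_exchanges_parts:
  fixes \<Lambda> :: "int \<Rightarrow> 'a::real_vector set"
  assumes d: "linear d" "\<And>p. d ` \<Lambda> p \<subseteq> \<Lambda> (p + 1)"
    and i: "linear i" "\<And>p. i ` \<Lambda> p \<subseteq> \<Lambda> (p - 1)"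
  shows "(\<lambda>x. d x + i x) ` even_part \<Lambda> \<subseteq> odd_part \<Lambda>"
    and "(\<lambda>x. d x + i x) ` odd_part \<Lambda> \<subseteq> even_part \<Lambda>"
proof -
  have lin: "linear (\<lambda>x. d x + i x)"
    using d(1) i(1) by (rule linear_compose_add)
  have "d x + i x \<in> odd_part \<Lambda>" if "x \<in> \<Lambda> p" "even p" for x p
    unfolding odd_part_def using that d(2) i(2)
    by (intro span_add span_base UN_I[of "p + 1"] UN_I[of "p - 1"]) (auto simp: image_subset_iff)
  then show "(\<lambda>x. d x + i x) ` even_part \<Lambda> \<subseteq> odd_part \<Lambda>"
    unfolding even_part_def linear_span_image[OF lin, symmetric]
    by (intro span_minimal) (auto simp: odd_part_def)
  have "d x + i x \<in> even_part \<Lambda>" if "x \<in> \<Lambda> p" "odd p" for x p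
    unfolding even_part_def using that d(2) i(2)
    by (intro span_add span_base UN_I[of "p + 1"] UN_I[of "p - 1"]) (auto simp: image_subset_iff)
  then show "(\<lambda>x. d x + i x) ` odd_part \<Lambda> \<subseteq> even_part \<Lambda>"
    unfolding odd_part_def linear_span_image[OF lin, symmetric]
    by (intro span_minimal) (auto simp: even_part_def)
qed

theorem proposition2:
  fixes \<Lambda> :: "int \<Rightarrow> 'a::real_vector set"
    and n :: nat
    and d i\<^sub>X :: "'a \<Rightarrow> 'a"
  assumes finite_dim: "\<exists>B. finite B \<and> span B = (UNIV :: 'a set)"
    and subspaces: "\<And>p. subspace (\<Lambda> p)"
    and outside: "\<And>p. p < 0 \<or> p > int n \<Longrightarrow> \<Lambda> p = {0}"
    and direct_sum: "\<And>x. \<exists>!f. (\<forall>p. f p \<in> \<Lambda> p) \<and> x = (\<Sum>p\<in>{0..int n}. f p)"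
    and d: "linear d" "\<And>p. d ` \<Lambda> p \<subseteq> \<Lambda> (p + 1)" "\<And>x. d (d x) = 0"
    and i: "linear i\<^sub>X" "\<And>p. i\<^sub>X ` \<Lambda> p \<subseteq> \<Lambda> (p - 1)" "\<And>x. i\<^sub>X (i\<^sub>X x) = 0"
  defines "L\<^sub>X \<equiv> lie_derivative i\<^sub>X d"
  shows "L\<^sub>X ` even_part \<Lambda> \<subseteq> even_part \<Lambda> \<and> L\<^sub>X ` odd_part \<Lambda> \<subseteq> odd_part \<Lambda> \<and>
    filter_mset (\<lambda>z. z \<noteq> 0) (complex_spectrum_on (even_part \<Lambda>) L\<^sub>X) =
    filter_mset (\<lambda>z. z \<noteq> 0) (complex_spectrum_on (odd_part \<Lambda>) L\<^sub>X)"
proof -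
  let ?D = "\<lambda>x. d x + i\<^sub>X x"
  have L: "L\<^sub>X = ?D \<circ> ?D"
    unfolding L\<^sub>X_def using d(1,3) i(1,3) by (rule lie_derivative_eq_square)
  have lin: "linear ?D"
    using d(1) i(1) by (rule linear_compose_add)
  note exch = odd_operator_exchanges_parts[OF d(1,2) i(1,2)]
  obtain B where B: "finite B" "span B = (UNIV :: 'a set)"
    using finite_dim by blast
  obtain bs cs where "basis_list (even_part \<Lambda>) bs" "basis_list (odd_part \<Lambda>) cs"
    using basis_list_exists[OF _ B(1), of "even_part \<Lambda>"] basis_list_exists[OF _ B(1), of "odd_part \<Lambda>"]
    by (auto simp: B(2) even_part_def odd_part_def)
  then have "filter_mset (\<lambda>z. z \<noteq> 0) (complex_spectrum_on (even_part \<Lambda>) L\<^sub>X) =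
      filter_mset (\<lambda>z. z \<noteq> 0) (complex_spectrum_on (odd_part \<Lambda>) L\<^sub>X)"
    unfolding L using lin exch by (rule nonzero_complex_spectrum_on_square)
  then show ?thesis
    using exch by (auto simp: L image_subset_iff)
qed

end
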